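(* Let $p\in\mathbb{C}$ with $\Re(p)>0$, $\nu\ge0$ real, $b_1,b_2,b_3\in\mathbb{C}$, $c_1\in\mathbb{C}\setminus\{0,-1,-2,\dots\}$, and $x,y\in\mathbb{C}$ with $|x|<1$, $|y|<1$. Then for all integers $M,N\ge0$, $$\frac{\partial^{M+N}}{\partial x^M\partial y^N}F_{1,p,\nu}(b_1,b_2,b_3;c_1;x,y)=\frac{(b_1)_{M+N}(b_2)_M(b_3)_N}{(c_1)_{M+N}}\,F_{1,p,\nu}(b_1+M+N,b_2+M,b_3+N;c_1+M+N;x,y).$$
   Context: $K_\alpha$ is the modified Bessel function of the second kind of order $\alpha$; powers and square roots take principal values. $(\lambda)_n$ is the Pochhammer symbol $\lambda(\lambda+1)\cdots(\lambda+n-1)$, $(\lambda)_0=1$, and $B(\alpha,\beta)=\Gamma(\alpha)\Gamma(\beta)/\Gamma(\alpha+\beta)$. For $\Re(p)>0$, $\nu\ge0$, $$B_{p,\nu}(u,v)=\sqrt{\frac{2p}{\pi}}\int_0^1 t^{u-\frac32}(1-t)^{v-\frac32}K_{\nu+\frac12}\!\left(\frac{p}{t(1-t)}\right)dt .$$ The extended Appell function is defined for $|x|<1$, $|y|<1$, $b_1,b_2,b_3\in\mathbb{C}$, $c_1\in\mathbb{C}\setminus\{0,-1,-2,\dots\}$ by $$F_{1,p,\nu}(b_1,b_2,b_3;c_1;x,y)=\sum_{m,n=0}^\infty\frac{(b_2)_m(b_3)_n\,B_{p,\nu}(b_1+m+n,c_1-b_1)}{B(b_1,c_1-b_1)}\frac{x^m}{m!}\frac{y^n}{n!},$$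 where $1/B(b_1,c_1-b_1)$ is read as $\Gamma(c_1)/(\Gamma(b_1)\Gamma(c_1-b_1))$, with $1/\Gamma$ the entire reciprocal Gamma function. *)

theory Defs
  imports "HOL-Complex_Analysis.Complex_Analysis"
begin

text \<open>
  The modified Bessel function of the second kind, given by its classical integral
  (DLMF 10.32.9), which converges absolutely exactly on the half-plane \<open>Re z > 0\<close>. Below it is only
  evaluated at points \<open>p / (t (1 - t))\<close> with \<open>Re p > 0\<close> and \<open>0 < t < 1\<close>, all of which
  lie in this half-plane.
\<close>

definition bessel_K :: "real \<Rightarrow> complex \<Rightarrow> complex" where
  "bessel_K \<alpha> z =
     (LINT s:{0..}|lborel. exp (- z * of_real (cosh s)) * of_real (cosh (\<alpha> * s)))"

definition ext_Beta :: "complex \<Rightarrow> real \<Rightarrow> complex \<Rightarrow> complex \<Rightarrow> complex" where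
  "ext_Beta p \<nu> u v =
     csqrt (2 * p / of_real pi) *
     (LINT t:{0<..<1}|lborel.
        of_real t powr (u - 3 / 2) * of_real (1 - t) powr (v - 3 / 2) *
        bessel_K (\<nu> + 1 / 2) (p / of_real (t * (1 - t))))"

text \<open>
  The factor \<open>1 / B(b1, c1 - b1)\<close> is written with the entire function \<open>rGamma\<close>, so that it
  is meaningful (and vanishes) when \<open>b1\<close> or \<open>c1 - b1\<close> is a nonpositive integer.
  The double series is summed unconditionally over all pairs \<open>(m, n)\<close>.
\<close>

definition ext_Appell_F1 ::
  "complex \<Rightarrow> real \<Rightarrow> complex \<Rightarrow> complex \<Rightarrow> complex \<Rightarrow> complex \<Rightarrow> complex \<Rightarrow> complex \<Rightarrow> complex"
where
  "ext_Appell_F1 p \<nu> b1 b2 b3 c1 x y =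
     (\<Sum>\<^sub>\<infinity>(m, n)\<in>UNIV.
        pochhammer b2 m * pochhammer b3 n * ext_Beta p \<nu> (b1 + of_nat (m + n)) (c1 - b1) *
        (Gamma c1 * rGamma b1 * rGamma (c1 - b1)) *
        (x ^ m / fact m) * (y ^ n / fact n))"

end

theory Submission
  imports Defs
begin

text \<open>
  Since \<open>rGamma b1 = pochhammer b1 k * rGamma (b1 + k)\<close>, shifting \<open>b1\<close> and \<open>c1\<close> by the same \<open>k\<close>
  changes the normalising factor by exactly the claimed quotient of Pochhammer symbols, and leaves
  \<open>c1 - b1\<close> alone. What remains is termwise differentiation of a double power series with
  coefficients \<open>pochhammer a m * pochhammer b n * c (m + n) / (m! n!)\<close>, legitimate in the unit
  bidisc as soon as the sequence \<open>c\<close> is bounded. No estimate on the Bessel function is needed for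
  this: the integrands of successive extended Beta values differ by factors of modulus at most 1,
  so from the first integrable one on they are dominated by it, and a
  non-integrable integrand has integral 0.
\<close>

section \<open>Double power series with coefficients depending on the sum of the indices\<close>

text \<open>As \<open>c\<close> sees only \<open>m + n\<close>, differentiating in either variable
  acts on it by the same shift.\<close>

definition appell_series ::
  "(nat \<Rightarrow> complex) \<Rightarrow> complex \<Rightarrow> complex \<Rightarrow> complex \<Rightarrow> complex \<Rightarrow> complex" where
  "appell_series c a b x y =
     (\<Sum>\<^sub>\<infinity>(m, n)\<in>UNIV. c (m + n) * (pochhammer a m * x ^ m / fact m) * (pochhammer b n * y ^ n / fact n))"

text \<open>Up to the sign \<open>(-1) ^ n\<close>, the coefficients are the binomial coefficients
  of the exponent \<open>-a\<close>: this is the series of \<open>(1 - x) powr (-a)\<close>, with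
  radius of convergence at least 1.\<close>

lemma abs_summable_binomial_series:
  fixes a x :: complex
  assumes "norm x < 1"
  shows "(\<lambda>n. norm (pochhammer a n * x ^ n / fact n)) summable_on UNIV"
proof -
  have "ereal (norm x) < conv_radius (\<lambda>n. (-a) gchoose n)"
    using assms by (auto simp: conv_radius_gchoose)
  hence "summable (\<lambda>n. norm (((-a) gchoose n) * x ^ n))"
    by (rule abs_summable_in_conv_radius)
  moreover have "norm (((-a) gchoose n) * x ^ n) = norm (pochhammer a n * x ^ n / fact n)" for n
    by (simp add: gbinomial_pochhammer norm_mult norm_divide norm_power)
  ultimately show ?thesis
    by (simp add: summable_on_UNIV_nonneg_real_iff)
qed

text \<open>A bound \<open>C\<close> for \<open>c\<close> gives as majorant \<open>C\<close> times a
  product of two absolutely convergent single series.\<close>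

lemma abs_summable_appell_series:
  fixes c :: "nat \<Rightarrow> complex"
  assumes "bounded (range c)" "norm x < 1" "norm y < 1"
  shows "(\<lambda>p. norm ((\<lambda>(m, n). c (m + n) * (pochhammer a m * x ^ m / fact m) *
           (pochhammer b n * y ^ n / fact n)) p)) summable_on UNIV"
proof -
  obtain C where C: "\<And>k. norm (c k) \<le> C"
    using assms(1) by (auto simp: bounded_iff)
  let ?f = "\<lambda>m. pochhammer a m * x ^ m / fact m" and ?g = "\<lambda>n. pochhammer b n * y ^ n / fact n"
  have "(\<lambda>p. norm ((\<lambda>(m, n). ?f m * ?g n) p)) summable_on UNIV \<times> UNIV"
    unfolding Infinite_Sum.abs_summable_on_Sigma_iff case_prod_conv norm_mult infsum_cmult_right'
    using abs_summable_binomial_series[OF assms(2), of a] abs_summable_binomial_series[OF assms(3), of b]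
    by (auto intro!: summable_on_cmult_right summable_on_cmult_left simp del: norm_divide times_divide_eq_right)
  hence "(\<lambda>p. C * norm ((\<lambda>(m, n). ?f m * ?g n) p)) summable_on UNIV"
    by (intro summable_on_cmult_right) simp
  thus ?thesis
  proof (rule Infinite_Sum.abs_summable_on_comparison_test')
    fix p :: "nat \<times> nat"
    show "norm ((\<lambda>(m, n). c (m + n) * ?f m * ?g n) p) \<le> C * norm ((\<lambda>(m, n). ?f m * ?g n) p)"
      using C[of "fst p + snd p"]
      by (auto simp: case_prod_beta norm_mult mult.assoc simp del: norm_divide times_divide_eq_right
               intro!: mult_right_mono)
  qed
qed

text \<open>This carries every result about the last variable over to the other one.\<close>

lemma appell_series_commute: "appell_series c a b x y = appell_series c b a y x"
proof -
  have "bij_betw prod.swap (UNIV :: (nat \<times> nat) set) UNIV"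
    by (simp add: bij_swap)
  from infsum_reindex_bij_betw[OF this, of "\<lambda>(m, n). c (m + n) * (pochhammer b m * y ^ m / fact m) * (pochhammer a n * x ^ n / fact n)"]
  show ?thesis
    unfolding appell_series_def by (simp add: case_prod_unfold ac_simps)
qed

text \<open>Summing over \<open>m\<close> first leaves an ordinary power series in \<open>y\<close>,
  open to one-variable termwise differentiation.\<close>

lemma appell_series_sums:
  assumes "bounded (range c)" "norm x < 1" "norm y < 1"
  shows "(\<lambda>n. (\<Sum>\<^sub>\<infinity>m. c (m + n) * (pochhammer a m * x ^ m / fact m)) * pochhammer b n / fact n * y ^ n)
           sums appell_series c a b x y"
proof -
  let ?h = "\<lambda>m n. c (m + n) * (pochhammer a m * x ^ m / fact m) * (pochhammer b n * y ^ n / fact n)"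
  have "(\<lambda>p. ?h (fst p) (snd p)) summable_on UNIV"
    using abs_summable_summable[OF abs_summable_appell_series[OF assms]] by (simp add: case_prod_unfold)
  hence "((\<lambda>p. ?h (fst p) (snd p)) has_sum appell_series c a b x y) UNIV"
    unfolding appell_series_def case_prod_unfold by (rule has_sum_infsum)
  \<comment> \<open>The indices are swapped so that \<open>n\<close> becomes the outer one.\<close>
  hence "((\<lambda>p. ?h (snd p) (fst p)) has_sum appell_series c a b x y) UNIV"
    using has_sum_reindex_bij_betw[of prod.swap UNIV UNIV "\<lambda>p. ?h (fst p) (snd p)"]
    by (simp add: bij_swap)
  hence *: "((\<lambda>(n, m). ?h m n) has_sum appell_series c a b x y) (UNIV \<times> UNIV)"
    by (simp add: case_prod_unfold)
  have row: "(\<lambda>m. ?h m n) summable_on UNIV" for n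
    using has_sum_imp_summable[OF *] by (rule summable_on_SigmaD1) simp
  have "((\<lambda>n. \<Sum>\<^sub>\<infinity>m. ?h m n) has_sum appell_series c a b x y) UNIV"
    by (rule has_sum_SigmaD[OF *]) (simp only: case_prod_conv has_sum_infsum[OF row])
  hence "(\<lambda>n. \<Sum>\<^sub>\<infinity>m. ?h m n) sums appell_series c a b x y"
    by (rule has_sum_imp_sums)
  moreover have "(\<Sum>\<^sub>\<infinity>m. ?h m n) =
      (\<Sum>\<^sub>\<infinity>m. c (m + n) * (pochhammer a m * x ^ m / fact m)) * pochhammer b n / fact n * y ^ n" for n
    by (subst infsum_cmult_left') simp
  ultimately show ?thesis
    by simp
qed

lemma has_field_derivative_appell_series:
  assumes c: "bounded (range c)" and x: "norm x < 1" and y: "norm y < 1"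
  shows "(appell_series c a b x has_field_derivative
           b * appell_series (\<lambda>k. c (Suc k)) a (b + 1) x y) (at y)"
proof -
  define d where "d n = (\<Sum>\<^sub>\<infinity>m. c (m + n) * (pochhammer a m * x ^ m / fact m)) * pochhammer b n / fact n" for n
  have d: "(\<lambda>n. d n * v ^ n) sums appell_series c a b x v" if "norm v < 1" for v
    using appell_series_sums[OF c x that, of a b] by (simp add: d_def)
  have "((\<lambda>v. \<Sum>n. d n * v ^ n) has_field_derivative (\<Sum>n. diffs d n * y ^ n)) (at y)"
    using y by (intro termdiffs_strong'[of 1]) (auto dest: d simp: sums_iff)
  moreover have "(\<Sum>n. diffs d n * y ^ n) = b * appell_series (\<lambda>k. c (Suc k)) a (b + 1) x y"
  proof -
    have c': "bounded (range (\<lambda>k. c (Suc k)))"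
      by (rule bounded_subset[OF c]) auto
    \<comment> \<open>The factor \<open>Suc n\<close> from differentiation reduces
      \<open>fact (Suc n)\<close> to \<open>fact n\<close>, and
      \<open>pochhammer b (Suc n) = b * pochhammer (b + 1) n\<close>.\<close>
    have "diffs d n * y ^ n = b * ((\<Sum>\<^sub>\<infinity>m. c (Suc (m + n)) * (pochhammer a m * x ^ m / fact m)) *
            pochhammer (b + 1) n / fact n * y ^ n)" for n
      by (simp add: diffs_def d_def pochhammer_rec field_simps del: of_nat_Suc)
    thus ?thesis
      using sums_unique[OF sums_mult[OF appell_series_sums[OF c' x y], of b a "b + 1"]] by simp
  qed
  ultimately have "((\<lambda>v. \<Sum>n. d n * v ^ n) has_field_derivative
      b * appell_series (\<lambda>k. c (Suc k)) a (b + 1) x y) (at y)"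
    by simp
  thus ?thesis
    by (rule has_field_derivative_transform_within_open[of _ _ _ "ball 0 1"]) (use y d in \<open>auto simp: sums_iff\<close>)
qed

lemma holomorphic_appell_series:
  assumes "bounded (range c)" "norm x < 1"
  shows "appell_series c a b x holomorphic_on ball 0 1"
  using has_field_derivative_appell_series[OF assms] by (force simp: holomorphic_on_open)

lemma higher_deriv_appell_series:
  assumes "bounded (range c)" "norm x < 1" "norm y < 1"
  shows "(deriv ^^ N) (appell_series c a b x) y =
           pochhammer b N * appell_series (\<lambda>k. c (k + N)) a (b + of_nat N) x y"
  using assms(1,3)
\<comment> \<open>The point varies because the next derivative needs the formula on a whole
  neighbourhood.\<close>
proof (induction N arbitrary: y)
  case (Suc N)
  have c': "bounded (range (\<lambda>k. c (k + N)))"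
    by (rule bounded_subset[OF Suc.prems(1)]) auto
  have "(deriv ^^ Suc N) (appell_series c a b x) y = deriv ((deriv ^^ N) (appell_series c a b x)) y"
    by simp
  also have "\<dots> = pochhammer b N * ((b + of_nat N) * appell_series (\<lambda>k. c (Suc k + N)) a (b + of_nat N + 1) x y)"
  proof (rule DERIV_imp_deriv, rule has_field_derivative_transform_within_open[of _ _ _ "ball 0 1"])
    show "((\<lambda>v. pochhammer b N * appell_series (\<lambda>k. c (k + N)) a (b + of_nat N) x v) has_field_derivative
        pochhammer b N * ((b + of_nat N) * appell_series (\<lambda>k. c (Suc k + N)) a (b + of_nat N + 1) x y)) (at y)"
      by (intro DERIV_cmult has_field_derivative_appell_series[OF c' assms(2) Suc.prems(2)])
  qed (use Suc in auto)
  finally show ?case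
    by (simp add: pochhammer_Suc add_ac)
qed simp

section \<open>Boundedness of the extended Beta values\<close>

text \<open>Bounding \<open>g\<close> only where \<open>f\<close> is nonzero lets \<open>f\<close>
  absorb the indicator of the domain of integration.\<close>

lemma bounded_lebesgue_integral_power_mult:
  fixes g :: "'a \<Rightarrow> real" and f :: "'a \<Rightarrow> 'b::{banach, second_countable_topology}"
  assumes g: "\<And>x. f x \<noteq> 0 \<Longrightarrow> \<bar>g x\<bar> \<le> 1"
  shows "bounded (range (\<lambda>k. LINT x|M. g x ^ k *\<^sub>R f x))"
proof (cases "\<exists>k. integrable M (\<lambda>x. g x ^ k *\<^sub>R f x)")
  case False
  thus ?thesis
    by (simp add: not_integrable_integral_eq)
next
  case True
  \<comment> \<open>Below \<open>k0\<close> the integrals are 0 by convention; from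
    \<open>k0\<close> on the norms of the integrands are dominated by the one at
    \<open>k0\<close>.\<close>
  define k0 where "k0 = (LEAST k. integrable M (\<lambda>x. g x ^ k *\<^sub>R f x))"
  have k0: "integrable M (\<lambda>x. g x ^ k0 *\<^sub>R f x)"
    unfolding k0_def using True by (rule LeastI_ex)
  have "norm (LINT x|M. g x ^ k *\<^sub>R f x) \<le> (LINT x|M. norm (g x ^ k0 *\<^sub>R f x))" for k
  proof (cases "k < k0")
    case True
    hence "\<not> integrable M (\<lambda>x. g x ^ k *\<^sub>R f x)"
      unfolding k0_def by (rule not_less_Least)
    thus ?thesis
      by (simp add: not_integrable_integral_eq)
  next
    case False
    have "norm (LINT x|M. g x ^ k *\<^sub>R f x) \<le> (LINT x|M. norm (g x ^ k *\<^sub>R f x))"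
      by (rule integral_norm_bound)
    also have "\<dots> \<le> (LINT x|M. norm (g x ^ k0 *\<^sub>R f x))"
    proof (rule integral_mono')
      fix x
      show "norm (g x ^ k *\<^sub>R f x) \<le> norm (g x ^ k0 *\<^sub>R f x)"
        using False g[of x]
        by (cases "f x = 0") (auto simp: power_abs intro!: mult_right_mono power_decreasing)
    qed (use integrable_norm[OF k0] in auto)
    finally show ?thesis .
  qed
  thus ?thesis
    by (auto simp: bounded_iff)
qed

text \<open>Raising \<open>u\<close> by \<open>k\<close> multiplies the integrand by
  \<open>t ^ k\<close>, where \<open>0 < t < 1\<close>.\<close>

lemma bounded_ext_Beta: "bounded (range (\<lambda>k. ext_Beta p \<nu> (u + of_nat k) v))"
proof -
  define f where "f t = indicat_real {0<..<1} t *\<^sub>R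
    (of_real t powr (u - 3 / 2) * of_real (1 - t) powr (v - 3 / 2) *
     bessel_K (\<nu> + 1 / 2) (p / of_real (t * (1 - t))))" for t
  have "bounded (range (\<lambda>k. LINT t|lborel. t ^ k *\<^sub>R f t))"
    by (rule bounded_lebesgue_integral_power_mult) (auto simp: f_def indicator_def split: if_splits)
  hence "bounded ((\<lambda>z. csqrt (2 * p / of_real pi) * z) ` range (\<lambda>k. LINT t|lborel. t ^ k *\<^sub>R f t))"
    by (rule bounded_linear_image) (rule bounded_linear_mult_right)
  moreover have "ext_Beta p \<nu> (u + of_nat k) v =
      csqrt (2 * p / of_real pi) * (LINT t|lborel. t ^ k *\<^sub>R f t)" for k
  proof -
    have "indicat_real {0<..<1} t *\<^sub>R
        (of_real t powr (u + of_nat k - 3 / 2) * of_real (1 - t) powr (v - 3 / 2) *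
         bessel_K (\<nu> + 1 / 2) (p / of_real (t * (1 - t)))) = t ^ k *\<^sub>R f t" for t
    proof (cases "t \<in> {0<..<1}")
      case True
      have "of_real t powr (u + of_nat k - 3 / 2) = of_real t powr (u - 3 / 2) * (of_real t ^ k :: complex)"
        using True powr_add[of "of_real t :: complex" "u - 3 / 2" "of_nat k"]
        by (simp add: powr_nat' algebra_simps)
      thus ?thesis
        using True by (simp add: f_def scaleR_conv_of_real)
    qed (simp add: f_def)
    thus ?thesis
      by (simp add: ext_Beta_def set_lebesgue_integral_def)
  qed
  ultimately show ?thesis
    by (simp add: image_image)
qed

section \<open>Parameter shifts and the derivative formula\<close>

definition appell_coeff ::
  "complex \<Rightarrow> real \<Rightarrow> complex \<Rightarrow> complex \<Rightarrow> nat \<Rightarrow> complex" where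
  "appell_coeff p \<nu> b1 c1 k =
     Gamma c1 * rGamma b1 * rGamma (c1 - b1) * ext_Beta p \<nu> (b1 + of_nat k) (c1 - b1)"

lemma ext_Appell_F1_eq_appell_series:
  "ext_Appell_F1 p \<nu> b1 b2 b3 c1 = appell_series (appell_coeff p \<nu> b1 c1) b2 b3"
  unfolding ext_Appell_F1_def appell_series_def appell_coeff_def
  by (intro ext infsum_cong) (auto simp: field_simps)

lemma bounded_appell_coeff: "bounded (range (appell_coeff p \<nu> b1 c1))"
proof -
  have "bounded ((\<lambda>z. Gamma c1 * rGamma b1 * rGamma (c1 - b1) * z) `
      range (\<lambda>k. ext_Beta p \<nu> (b1 + of_nat k) (c1 - b1)))"
    by (rule bounded_linear_image[OF bounded_ext_Beta]) (rule bounded_linear_mult_right)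
  thus ?thesis
    by (simp add: image_image appell_coeff_def[abs_def])
qed

text \<open>The Beta values on both sides coincide, since \<open>b1 + (k + n) = (b1 + n) + k\<close>
  and \<open>c1 - b1\<close> is unchanged. Only \<open>Gamma c1 * rGamma b1\<close> changes; written
  with \<open>rGamma\<close>, the recurrence in \<open>b1\<close> also holds at poles of
  \<open>Gamma\<close>.\<close>

lemma appell_coeff_add:
  assumes "c1 \<notin> \<int>\<^sub>\<le>\<^sub>0"
  shows "appell_coeff p \<nu> b1 c1 (k + n) =
     pochhammer b1 n / pochhammer c1 n * appell_coeff p \<nu> (b1 + of_nat n) (c1 + of_nat n) k"
proof -
  have "pochhammer c1 n \<noteq> 0"
    using assms by (auto simp: pochhammer_eq_0_iff)
  moreover have "Gamma (c1 + of_nat n) = pochhammer c1 n * Gamma c1"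
    using assms pochhammer_Gamma[of c1 n] by (simp add: Gamma_eq_zero_iff)
  ultimately show ?thesis
    using pochhammer_rGamma[of b1 n] by (simp add: appell_coeff_def add_ac)
qed

lemma appell_series_cmult: "appell_series (\<lambda>k. r * c k) a b x y = r * appell_series c a b x y"
  unfolding appell_series_def
  by (subst infsum_cmult_right'[symmetric]) (simp add: case_prod_unfold mult.assoc)

text \<open>\<open>deriv\<close> has a value even where no derivative exists; the holomorphy claims
  make the iterated \<open>deriv\<close> genuine partial derivatives.\<close>

theorem theorem4:
  fixes p b1 b2 b3 c1 x y :: complex and \<nu> :: real and M N :: nat
  assumes "Re p > 0" and "\<nu> \<ge> 0"
    and "c1 \<notin> \<int>\<^sub>\<le>\<^sub>0"
    and "norm x < 1" and "norm y < 1"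
  shows "(\<lambda>v. ext_Appell_F1 p \<nu> b1 b2 b3 c1 x v) holomorphic_on ball 0 1 \<and>
         (\<lambda>u. (deriv ^^ N) (\<lambda>v. ext_Appell_F1 p \<nu> b1 b2 b3 c1 u v) y) holomorphic_on ball 0 1 \<and>
         (deriv ^^ M) (\<lambda>u. (deriv ^^ N) (\<lambda>v. ext_Appell_F1 p \<nu> b1 b2 b3 c1 u v) y) x =
           pochhammer b1 (M + N) * pochhammer b2 M * pochhammer b3 N / pochhammer c1 (M + N) *
           ext_Appell_F1 p \<nu> (b1 + of_nat (M + N)) (b2 + of_nat M) (b3 + of_nat N)
             (c1 + of_nat (M + N)) x y"
proof -
  define c where "c = appell_coeff p \<nu> b1 c1"
  \<comment> \<open>The arguments are swapped so that \<open>x\<close> takes the last place, the one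
    in which derivatives are known.\<close>
  define G where "G = appell_series (\<lambda>k. c (k + N)) (b3 + of_nat N) b2 y"
  have c: "bounded (range c)"
    unfolding c_def by (rule bounded_appell_coeff)
  have c': "bounded (range (\<lambda>k. c (k + N)))"
    by (rule bounded_subset[OF c]) auto
  have F: "ext_Appell_F1 p \<nu> b1 b2 b3 c1 = appell_series c b2 b3"
    unfolding c_def by (rule ext_Appell_F1_eq_appell_series)
  have dy: "(deriv ^^ N) (ext_Appell_F1 p \<nu> b1 b2 b3 c1 u) y = pochhammer b3 N * G u"
    if "norm u < 1" for u
    using higher_deriv_appell_series[OF c that assms(5), of N b2 b3]
    by (simp add: F G_def appell_series_commute[of _ _ _ y])
  have holG: "G holomorphic_on ball 0 1"
    unfolding G_def by (rule holomorphic_appell_series[OF c' assms(5)])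
  have "(\<lambda>u. pochhammer b3 N * G u) holomorphic_on ball 0 1"
    by (intro holomorphic_intros holG)
  hence hol: "(\<lambda>u. (deriv ^^ N) (ext_Appell_F1 p \<nu> b1 b2 b3 c1 u) y) holomorphic_on ball 0 1"
    by (rule holomorphic_transform) (simp add: dy)
  \<comment> \<open>The inner derivative is known only for \<open>norm u < 1\<close>, so the
    functions are compared on the open disc around 0, which contains \<open>x\<close>.\<close>
  have "(deriv ^^ M) (\<lambda>u. (deriv ^^ N) (ext_Appell_F1 p \<nu> b1 b2 b3 c1 u) y) x =
      (deriv ^^ M) (\<lambda>u. pochhammer b3 N * G u) x"
    by (rule higher_deriv_transform_within_open[OF hol, of _ x M])
       (use assms(4) in \<open>auto intro!: holomorphic_intros holG simp: dy\<close>)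
  also have "\<dots> = pochhammer b3 N * (deriv ^^ M) G x"
    by (rule higher_deriv_cmult[OF holG]) (use assms(4) in auto)
  \<comment> \<open>The shifts by \<open>M\<close> and \<open>N\<close> add up in \<open>c\<close>;
    commuting back restores the order of the variables.\<close>
  also have "(deriv ^^ M) G x =
      pochhammer b2 M * appell_series (\<lambda>k. c (k + (M + N))) (b2 + of_nat M) (b3 + of_nat N) x y"
    using higher_deriv_appell_series[OF c' assms(5,4), of M "b3 + of_nat N" b2]
    by (simp add: G_def appell_series_commute[of _ _ _ y] add.assoc)
  also have "appell_series (\<lambda>k. c (k + (M + N))) (b2 + of_nat M) (b3 + of_nat N) x y =
      pochhammer b1 (M + N) / pochhammer c1 (M + N) *
      ext_Appell_F1 p \<nu> (b1 + of_nat (M + N)) (b2 + of_nat M) (b3 + of_nat N) (c1 + of_nat (M + N)) x y"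
    unfolding c_def appell_coeff_add[OF assms(3)] appell_series_cmult ext_Appell_F1_eq_appell_series ..
  finally show ?thesis
    using hol holomorphic_appell_series[OF c assms(4), of b2 b3] by (simp add: F)
qed

end
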